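(* Let $Z$ be a Banach space with a monotone basis $(e_m)_{m\in\mathbb{N}}$ and for each $m\in\mathbb{N}$ let $X_m=\mathrm{span}\{e_k: 1\leq k\leq m\}$. Then $$n(Z)\geq\limsup_{m\to\infty}n(X_m).$$
   Context: For a Banach space $X$ (real or complex), $S_X$ and $X^*$ denote its unit sphere and dual, and $L(X)$ the bounded linear operators on $X$. Put $\Pi(X)=\{(x,x^* )\in S_X\times S_{X^*}: x^*(x)=1\}$. The numerical radius of $T\in L(X)$ is $v(T)=\sup\{|x^*(Tx)|:(x,x^* )\in\Pi(X)\}$, and the numerical index of $X$ is $n(X)=\inf\{v(T): T\in L(X),\ \|T\|=1\}$. A (Schauder) basis is monotone if its basis constant is $1$, i.e. the partial-sum projections associated to the basis all have norm $1$. *)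

theory Defs
  imports "HOL-Analysis.Analysis"
begin

text \<open>
  Spaces over the real or the complex field are treated uniformly: the scalars form a
  type \<open>'k\<close> of class \<^class>\<open>real_normed_field\<close>, and a second scalar multiplication by \<open>'k\<close> is
  given on a real normed space, compatible with its norm and real structure. By the
  Gelfand-Mazur theorem (applied to the completion) the only real normed fields are, up to isometric
  isomorphism, the real and the complex numbers. For real scalars the compatibility forces the
  multiplication to be \<^const>\<open>scaleR\<close>.
\<close>

locale normed_space_over = vector_space scale
  for scale :: "'k::real_normed_field \<Rightarrow> 'a::real_normed_vector \<Rightarrow> 'a" +
  assumes norm_scale: "norm (scale c x) = norm c * norm x"
    and scale_of_real: "scale (of_real r) x = r *\<^sub>R x"

lemma normed_space_over_scaleR:
  "normed_space_over (scaleR :: real \<Rightarrow> 'a::real_normed_vector \<Rightarrow> 'a)"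
  by unfold_locales (simp_all add: algebra_simps)

lemma normed_space_over_real_iff:
  "normed_space_over (s :: real \<Rightarrow> 'a::real_normed_vector \<Rightarrow> 'a) \<longleftrightarrow> s = scaleR"
proof
  assume "normed_space_over s"
  then interpret normed_space_over s .
  show "s = scaleR"
    using scale_of_real by (auto simp: fun_eq_iff)
qed (simp add: normed_space_over_scaleR)

lemma normed_space_over_complex: "normed_space_over ((*) :: complex \<Rightarrow> complex \<Rightarrow> complex)"
  by unfold_locales (simp_all add: algebra_simps norm_mult scaleR_conv_of_real)


text \<open>
  Subspaces are carrier sets \<open>X\<close>. Maps on \<open>X\<close> are represented by total functions, of which only
  the values on \<open>X\<close> matter.
\<close>

definition bounded_linear_on ::
    "('k \<Rightarrow> 'a::real_normed_vector \<Rightarrow> 'a) \<Rightarrow> ('k \<Rightarrow> 'b::real_normed_vector \<Rightarrow> 'b) \<Rightarrow> 'a set \<Rightarrow> ('a \<Rightarrow> 'b) \<Rightarrow> bool"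
  where "bounded_linear_on s t X f \<longleftrightarrow>
    (\<forall>x\<in>X. \<forall>y\<in>X. f (x + y) = f x + f y) \<and>
    (\<forall>c. \<forall>x\<in>X. f (s c x) = t c (f x)) \<and>
    (\<exists>K. \<forall>x\<in>X. norm (f x) \<le> norm x * K)"

definition onorm_on :: "'a::real_normed_vector set \<Rightarrow> ('a \<Rightarrow> 'b::real_normed_vector) \<Rightarrow> real"
  where "onorm_on X f = (SUP x\<in>X. norm (f x) / norm x)"

lemma onorm_on_UNIV: "onorm_on UNIV f = onorm f"
  by (simp add: onorm_on_def onorm_def)

definition operators_on ::
    "('k \<Rightarrow> 'a::real_normed_vector \<Rightarrow> 'a) \<Rightarrow> 'a set \<Rightarrow> ('a \<Rightarrow> 'a) set"
  where "operators_on s X = {T. bounded_linear_on s s X T \<and> T ` X \<subseteq> X}"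

definition dual_on ::
    "('k::real_normed_field \<Rightarrow> 'a::real_normed_vector \<Rightarrow> 'a) \<Rightarrow> 'a set \<Rightarrow> ('a \<Rightarrow> 'k) set"
  where "dual_on s X = {f. bounded_linear_on s (*) X f}"

definition states_on ::
    "('k::real_normed_field \<Rightarrow> 'a::real_normed_vector \<Rightarrow> 'a) \<Rightarrow> 'a set \<Rightarrow> ('a \<times> ('a \<Rightarrow> 'k)) set"
  where "states_on s X =
    {(x, f). x \<in> X \<and> norm x = 1 \<and> f \<in> dual_on s X \<and> onorm_on X f = 1 \<and> f x = 1}"

definition numerical_radius ::
    "('k::real_normed_field \<Rightarrow> 'a::real_normed_vector \<Rightarrow> 'a) \<Rightarrow> 'a set \<Rightarrow> ('a \<Rightarrow> 'a) \<Rightarrow> real"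
  where "numerical_radius s X T = (SUP (x, f)\<in>states_on s X. norm (f (T x)))"

definition numerical_index ::
    "('k::real_normed_field \<Rightarrow> 'a::real_normed_vector \<Rightarrow> 'a) \<Rightarrow> 'a set \<Rightarrow> real"
  where "numerical_index s X =
    (INF T\<in>{T \<in> operators_on s X. onorm_on X T = 1}. numerical_radius s X T)"


definition schauder_basis ::
    "('k \<Rightarrow> 'a::real_normed_vector \<Rightarrow> 'a) \<Rightarrow> (nat \<Rightarrow> 'a) \<Rightarrow> bool"
  where "schauder_basis s e \<longleftrightarrow> (\<forall>x. \<exists>!a. (\<lambda>k. s (a k) (e k)) sums x)"

definition basis_coeffs ::
    "('k \<Rightarrow> 'a::real_normed_vector \<Rightarrow> 'a) \<Rightarrow> (nat \<Rightarrow> 'a) \<Rightarrow> 'a \<Rightarrow> nat \<Rightarrow> 'k"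
  where "basis_coeffs s e x = (THE a. (\<lambda>k. s (a k) (e k)) sums x)"

definition partial_sum_proj ::
    "('k \<Rightarrow> 'a::real_normed_vector \<Rightarrow> 'a) \<Rightarrow> (nat \<Rightarrow> 'a) \<Rightarrow> nat \<Rightarrow> 'a \<Rightarrow> 'a"
  where "partial_sum_proj s e m x = (\<Sum>k\<le>m. s (basis_coeffs s e x k) (e k))"

text \<open>
  \<^const>\<open>onorm\<close> is meaningful only for bounded operators, so having norm 1 includes boundedness.
\<close>

definition monotone_basis ::
    "('k \<Rightarrow> 'a::real_normed_vector \<Rightarrow> 'a) \<Rightarrow> (nat \<Rightarrow> 'a) \<Rightarrow> bool"
  where "monotone_basis s e \<longleftrightarrow> schauder_basis s e \<and>
    (\<forall>m. bounded_linear (partial_sum_proj s e m) \<and> onorm (partial_sum_proj s e m) = 1)"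

end

theory Submission
  imports Defs
begin

text \<open>
  Let \<open>P\<^sub>m\<close> be the partial sum projections, regarded as maps onto \<open>X\<^sub>m\<close>, and let \<open>T\<close> be an operator
  of norm 1 on the whole space. The idea is to compare \<open>T\<close> with its compressions
  \<open>S\<^sub>m = P\<^sub>m T\<close>, restricted to \<open>X\<^sub>m\<close>.

  Compressing does not increase the numerical radius: as \<open>P\<^sub>m\<close> is a contraction that fixes \<open>X\<^sub>m\<close>,
  every state \<open>(x, f)\<close> of \<open>X\<^sub>m\<close> extends to the state \<open>(x, f \<circ> P\<^sub>m)\<close> of the whole space, whose value
  on \<open>T\<close> is \<open>f (S\<^sub>m x)\<close> (\<open>numerical_radius_compression_le\<close>). On the other hand,
  \<open>P\<^sub>m T P\<^sub>m z\<close> converges to \<open>T z\<close> for every \<open>z\<close>, so that the norms of the \<open>S\<^sub>m\<close> eventually exceed every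
  number below 1 (\<open>compression_tendsto\<close>). Since the numerical index of \<open>X\<^sub>m\<close> times the norm of \<open>S\<^sub>m\<close> is at most the
  numerical radius of \<open>S\<^sub>m\<close> (\<open>numerical_index_mult_onorm_le\<close>), the limit superior of the indices is
  at most the numerical radius of \<open>T\<close>; it remains to take the infimum over \<open>T\<close>.

  The suprema over states are meaningful only when there are states. The Hahn-Banach theorem
  is avoided here: the first basis vector and its coefficient functional, suitably
  rescaled, form a state of every \<open>X\<^sub>m\<close>, because the projection onto the span of this vector is
  contractive (\<open>states_on_span_basis_nonempty\<close>).
\<close>

section \<open>Norms, states and numerical radii on a subspace\<close>

lemma bdd_above_norm_quotients:
  assumes "bounded_linear_on s t X f"
  shows "bdd_above ((\<lambda>x. norm (f x) / norm x) ` X)"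
proof -
  obtain K where K: "\<And>x. x \<in> X \<Longrightarrow> norm (f x) \<le> norm x * K"
    using assms unfolding bounded_linear_on_def by blast
  have "norm (f x) / norm x \<le> max K 0" if "x \<in> X" for x
    using K[OF that] by (cases "x = 0") (auto simp: divide_simps mult.commute le_max_iff_disj)
  then show ?thesis by (auto intro!: bdd_aboveI)
qed

lemma norm_le_onorm_on:
  assumes f: "bounded_linear_on s t X f" and x: "x \<in> X"
  shows "norm (f x) \<le> onorm_on X f * norm x"
proof (cases "x = 0")
  case True
  have "f 0 = 0" using f x True unfolding bounded_linear_on_def by fastforce
  with True show ?thesis by simp
next
  case False
  have "norm (f x) / norm x \<le> onorm_on X f"
    unfolding onorm_on_def by (rule cSUP_upper[OF x bdd_above_norm_quotients[OF f]])
  with False show ?thesis by (simp add: divide_simps)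
qed

lemma onorm_on_le:
  assumes "X \<noteq> {}" "0 \<le> B" "\<And>x. x \<in> X \<Longrightarrow> norm (f x) \<le> B * norm x"
  shows "onorm_on X f \<le> B"
  unfolding onorm_on_def
proof (rule cSUP_least)
  fix x assume "x \<in> X"
  with assms show "norm (f x) / norm x \<le> B"
    by (cases "x = 0") (auto simp: divide_simps)
qed (use assms in auto)

lemma onorm_on_nonneg:
  assumes "bounded_linear_on s t X f" "x \<in> X" "x \<noteq> 0"
  shows "0 \<le> onorm_on X f"
proof -
  have "0 \<le> onorm_on X f * norm x"
    using norm_le_onorm_on[OF assms(1,2)] norm_ge_zero[of "f x"] by linarith
  with assms show ?thesis by (simp add: zero_le_mult_iff)
qed

lemma norm_state_apply_le:
  assumes xf: "(x, f) \<in> states_on s X" and T: "T \<in> operators_on s X"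
  shows "norm (f (T x)) \<le> onorm_on X T"
proof -
  have x: "x \<in> X" "norm x = 1" and f: "bounded_linear_on s (*) X f" "onorm_on X f = 1"
    using xf by (auto simp: states_on_def dual_on_def)
  have T': "bounded_linear_on s s X T" "T x \<in> X"
    using T x by (auto simp: operators_on_def)
  show ?thesis
    using norm_le_onorm_on[OF f(1) T'(2)] norm_le_onorm_on[OF T'(1) x(1)] f(2) x(2) by simp
qed

lemma norm_state_apply_le_radius:
  assumes "(x, f) \<in> states_on s X" "T \<in> operators_on s X"
  shows "norm (f (T x)) \<le> numerical_radius s X T"
proof -
  have "bdd_above ((\<lambda>(x, f). norm (f (T x))) ` states_on s X)"
    using norm_state_apply_le[OF _ assms(2)] by (auto intro!: bdd_aboveI)
  from cSUP_upper[OF assms(1) this] show ?thesis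
    by (simp add: numerical_radius_def)
qed

lemma numerical_radius_le:
  assumes "states_on s X \<noteq> {}" "\<And>x f. (x, f) \<in> states_on s X \<Longrightarrow> norm (f (T x)) \<le> B"
  shows "numerical_radius s X T \<le> B"
  unfolding numerical_radius_def by (rule cSUP_least) (use assms in auto)

lemma numerical_radius_nonneg:
  assumes "states_on s X \<noteq> {}" "T \<in> operators_on s X"
  shows "0 \<le> numerical_radius s X T"
proof -
  obtain x f where "(x, f) \<in> states_on s X" using assms(1) by auto
  from norm_state_apply_le_radius[OF this assms(2)] show ?thesis
    using norm_ge_zero order_trans by blast
qed

lemma numerical_index_le_radius:
  assumes "states_on s X \<noteq> {}" "T \<in> operators_on s X" "onorm_on X T = 1"
  shows "numerical_index s X \<le> numerical_radius s X T"
  unfolding numerical_index_def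
proof (rule cINF_lower)
  show "bdd_below (numerical_radius s X ` {T \<in> operators_on s X. onorm_on X T = 1})"
    using numerical_radius_nonneg[OF assms(1)] by (auto intro!: bdd_belowI)
qed (use assms in auto)

context normed_space_over
begin

text \<open>
  The infimum that defines the index runs over operators of norm 1 only; dividing an operator by its
  norm turns this into an inequality for all operators.
\<close>

lemma numerical_index_mult_onorm_le:
  assumes X: "subspace X" and st: "states_on scale X \<noteq> {}"
    and S: "S \<in> operators_on scale X" and pos: "0 < onorm_on X S"
  shows "numerical_index scale X * onorm_on X S \<le> numerical_radius scale X S"
proof -
  define r where "r = 1 / onorm_on X S"
  define R where "R = (\<lambda>x. scale (of_real r) (S x))"
  have r: "r > 0" using pos by (simp add: r_def)
  have bl: "bounded_linear_on scale scale X S" and im: "S ` X \<subseteq> X"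
    using S by (auto simp: operators_on_def)
  have nR: "norm (R x) = r * norm (S x)" for x
    using r by (simp add: R_def norm_scale)
  have blR: "bounded_linear_on scale scale X R"
    unfolding bounded_linear_on_def
  proof (intro conjI ballI allI exI)
    fix x y assume "x \<in> X" "y \<in> X"
    then show "R (x + y) = R x + R y"
      using bl by (simp add: R_def bounded_linear_on_def scale_right_distrib)
  next
    fix c x assume "x \<in> X"
    then show "R (scale c x) = scale c (R x)"
      using bl by (simp add: R_def bounded_linear_on_def mult.commute)
  next
    fix x assume x: "x \<in> X"
    show "norm (R x) \<le> norm x * 1"
      using norm_le_onorm_on[OF bl x] pos by (simp add: nR r_def divide_simps mult.commute)
  qed
  have R: "R \<in> operators_on scale X"
    using blR im X by (auto simp: operators_on_def R_def subspace_def)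
  have "onorm_on X R = 1"
  proof (rule antisym)
    show "onorm_on X R \<le> 1"
    proof (rule onorm_on_le)
      show "X \<noteq> {}" using X subspace_0 by blast
      fix x assume x: "x \<in> X"
      show "norm (R x) \<le> 1 * norm x"
        using norm_le_onorm_on[OF bl x] pos by (simp add: nR r_def divide_simps mult.commute)
    qed simp
    have "onorm_on X S \<le> onorm_on X R / r"
    proof (rule onorm_on_le)
      show "X \<noteq> {}" using X subspace_0 by blast
      obtain x f where "(x, f) \<in> states_on scale X" using st by auto
      then have "x \<in> X" "x \<noteq> 0" by (auto simp: states_on_def)
      from onorm_on_nonneg[OF blR this] r show "0 \<le> onorm_on X R / r" by simp
      fix x assume x: "x \<in> X"
      show "norm (S x) \<le> onorm_on X R / r * norm x"
        using norm_le_onorm_on[OF blR x] r by (simp add: nR field_simps)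
    qed
    then show "1 \<le> onorm_on X R" using pos by (simp add: r_def divide_simps)
  qed
  then have "numerical_index scale X \<le> numerical_radius scale X R"
    by (rule numerical_index_le_radius[OF st R])
  also have "\<dots> \<le> r * numerical_radius scale X S"
  proof (rule numerical_radius_le[OF st])
    fix x f assume xf: "(x, f) \<in> states_on scale X"
    then have "x \<in> X" "bounded_linear_on scale (*) X f"
      by (auto simp: states_on_def dual_on_def)
    then have "f (R x) = of_real r * f (S x)"
      using im by (auto simp: R_def bounded_linear_on_def)
    then show "norm (f (R x)) \<le> r * numerical_radius scale X S"
      using norm_state_apply_le_radius[OF xf S] r by (simp add: norm_mult)
  qed
  finally show ?thesis using pos by (simp add: r_def divide_simps)
qed

end

section \<open>Compressions to one-complemented subspaces\<close>

locale contractive_projection = normed_space_over scale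
  for scale :: "'k::real_normed_field \<Rightarrow> 'a::real_normed_vector \<Rightarrow> 'a" +
  fixes P :: "'a \<Rightarrow> 'a" and X :: "'a set"
  assumes subspace: "subspace X"
    and proj_add: "P (x + y) = P x + P y"
    and proj_scale: "P (scale c x) = scale c (P x)"
    and norm_proj_le: "norm (P x) \<le> norm x"
    and proj_mem: "P x \<in> X"
    and proj_id: "x \<in> X \<Longrightarrow> P x = x"
begin

text \<open>
  A functional is extended by composing it with the projection, so norm-preserving
  extension is available without the Hahn-Banach theorem. Stating this for an
  arbitrary subspace \<open>Y\<close> above \<open>X\<close> covers the whole space as well as the passage from the span of
  one basis vector to a larger span.
\<close>

lemma state_extension:
  assumes xf: "(x, f) \<in> states_on scale X" and Y: "subspace Y" "X \<subseteq> Y"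
  shows "(x, \<lambda>y. f (P y)) \<in> states_on scale Y"
proof -
  have x: "x \<in> X" "norm x = 1" "f x = 1" and f: "bounded_linear_on scale (*) X f" "onorm_on X f = 1"
    using xf by (auto simp: states_on_def dual_on_def)
  have bd: "norm (f (P y)) \<le> norm y" for y
    using norm_le_onorm_on[OF f(1) proj_mem[of y]] f(2) norm_proj_le[of y] by simp
  have bl: "bounded_linear_on scale (*) Y (\<lambda>y. f (P y))"
    unfolding bounded_linear_on_def
  proof (intro conjI ballI allI exI)
    fix y assume "y \<in> Y" show "norm (f (P y)) \<le> norm y * 1" using bd by simp
  qed (use f(1) proj_mem in \<open>auto simp: bounded_linear_on_def proj_add proj_scale\<close>)
  have "onorm_on Y (\<lambda>y. f (P y)) = 1"
  proof (rule antisym)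
    show "onorm_on Y (\<lambda>y. f (P y)) \<le> 1"
      by (rule onorm_on_le) (use bd x Y in auto)
    show "1 \<le> onorm_on Y (\<lambda>y. f (P y))"
      using norm_le_onorm_on[OF bl, of x] x Y proj_id by auto
  qed
  then show ?thesis
    using bl x Y proj_id by (auto simp: states_on_def dual_on_def)
qed

lemma compression_operator:
  assumes T: "T \<in> operators_on scale UNIV"
  shows "(\<lambda>x. P (T x)) \<in> operators_on scale X"
proof -
  have bl: "bounded_linear_on scale scale UNIV T"
    using T by (simp add: operators_on_def)
  then obtain K where K: "\<And>x. norm (T x) \<le> norm x * K"
    unfolding bounded_linear_on_def by auto
  have "norm (P (T x)) \<le> norm x * K" for x
    using norm_proj_le[of "T x"] K[of x] by linarith
  then have "bounded_linear_on scale scale X (\<lambda>x. P (T x))"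
    using bl unfolding bounded_linear_on_def by (auto simp: proj_add proj_scale)
  then show ?thesis using proj_mem by (auto simp: operators_on_def)
qed

lemma numerical_radius_compression_le:
  assumes st: "states_on scale X \<noteq> {}" and T: "T \<in> operators_on scale UNIV"
  shows "numerical_radius scale X (\<lambda>x. P (T x)) \<le> numerical_radius scale UNIV T"
proof (rule numerical_radius_le[OF st])
  fix x f assume "(x, f) \<in> states_on scale X"
  from state_extension[OF this subspace_UNIV subset_UNIV]
  show "norm (f (P (T x))) \<le> numerical_radius scale UNIV T"
    using norm_state_apply_le_radius[OF _ T] by blast
qed

end

section \<open>Partial sum projections of a monotone basis\<close>

context normed_space_over
begin

lemma basis_coeffs_eqI:
  assumes "schauder_basis scale e" "(\<lambda>k. scale (a k) (e k)) sums x"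
  shows "basis_coeffs scale e x = a"
proof -
  have "\<exists>!a. (\<lambda>k. scale (a k) (e k)) sums x"
    using assms(1) by (simp only: schauder_basis_def)
  then show ?thesis
    unfolding basis_coeffs_def using assms(2) by (rule the1_equality[where P = "\<lambda>a. (\<lambda>k. scale (a k) (e k)) sums x"])
qed

lemma basis_coeffs_sums:
  assumes "schauder_basis scale e"
  shows "(\<lambda>k. scale (basis_coeffs scale e x k) (e k)) sums x"
proof -
  have "\<exists>!a. (\<lambda>k. scale (a k) (e k)) sums x"
    using assms by (simp only: schauder_basis_def)
  then show ?thesis
    unfolding basis_coeffs_def by (rule theI')
qed

lemma bounded_linear_scale: "bounded_linear (scale c)"
proof (rule bounded_linear_intro)
  fix r x
  show "scale c (r *\<^sub>R x) = r *\<^sub>R scale c x"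
    by (metis mult.commute scale_of_real scale_scale)
  show "norm (scale c x) \<le> norm x * norm c" by (simp add: norm_scale mult.commute)
qed (simp add: scale_right_distrib)

lemma basis_coeffs_add:
  assumes "schauder_basis scale e"
  shows "basis_coeffs scale e (x + y) = (\<lambda>k. basis_coeffs scale e x k + basis_coeffs scale e y k)"
  using sums_add[OF basis_coeffs_sums[OF assms, of x] basis_coeffs_sums[OF assms, of y]]
  by (intro basis_coeffs_eqI[OF assms]) (simp add: scale_left_distrib)

lemma basis_coeffs_scale:
  assumes "schauder_basis scale e"
  shows "basis_coeffs scale e (scale c x) = (\<lambda>k. c * basis_coeffs scale e x k)"
  using bounded_linear.sums[OF bounded_linear_scale basis_coeffs_sums[OF assms, of x], of c]
  by (intro basis_coeffs_eqI[OF assms]) simp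

lemma basis_coeffs_basis:
  assumes "schauder_basis scale e"
  shows "basis_coeffs scale e (e j) = (\<lambda>k. if k = j then 1 else 0)"
proof (rule basis_coeffs_eqI[OF assms])
  have "(\<lambda>k. scale (if k = j then 1 else 0) (e k)) = (\<lambda>k. if k = j then e k else 0)"
    by (simp add: fun_eq_iff)
  then show "(\<lambda>k. scale (if k = j then 1 else 0) (e k)) sums e j"
    by (simp only: sums_single)
qed

lemma basis_nonzero:
  assumes "schauder_basis scale e"
  shows "e j \<noteq> 0"
proof
  assume "e j = 0"
  then have "basis_coeffs scale e 0 j = 1"
    using basis_coeffs_basis[OF assms, of j] by simp
  moreover have "basis_coeffs scale e 0 = (\<lambda>_. 0)"
    by (rule basis_coeffs_eqI[OF assms]) simp
  ultimately show False by simp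
qed

lemma partial_sum_proj_tendsto:
  assumes "schauder_basis scale e"
  shows "(\<lambda>m. partial_sum_proj scale e m x) \<longlonglongrightarrow> x"
  using basis_coeffs_sums[OF assms, of x]
  unfolding partial_sum_proj_def sums_def_le .

lemma contractive_projection_partial_sum:
  assumes "monotone_basis scale e"
  shows "contractive_projection scale (partial_sum_proj scale e m) (span (e ` {..m}))"
proof unfold_locales
  have sb: "schauder_basis scale e"
    and on: "bounded_linear (partial_sum_proj scale e m)" "onorm (partial_sum_proj scale e m) = 1"
    using assms by (auto simp: monotone_basis_def)
  show "subspace (span (e ` {..m}))" by simp
  show add: "partial_sum_proj scale e m (x + y) =
      partial_sum_proj scale e m x + partial_sum_proj scale e m y" for x y
    by (simp add: partial_sum_proj_def basis_coeffs_add[OF sb] scale_left_distrib sum.distrib)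
  show scl: "partial_sum_proj scale e m (scale c x) = scale c (partial_sum_proj scale e m x)" for c x
    by (simp add: partial_sum_proj_def basis_coeffs_scale[OF sb] scale_sum_right)
  show "norm (partial_sum_proj scale e m x) \<le> norm x" for x
    using onorm[OF on(1), of x] on(2) by simp
  show "partial_sum_proj scale e m x \<in> span (e ` {..m})" for x
    unfolding partial_sum_proj_def by (intro span_sum span_scale span_base) auto
  show "partial_sum_proj scale e m x = x" if "x \<in> span (e ` {..m})" for x
    using that
  proof (induction rule: span_induct)
    case base
    have "partial_sum_proj scale e m 0 = 0" using scl[of 0 0] by simp
    then show ?case by (auto simp: subspace_def add scl)
  next
    case (step x)
    then obtain j where j: "j \<le> m" "x = e j" by auto
    have "partial_sum_proj scale e m (e j) = (\<Sum>k\<le>m. if k = j then e k else 0)"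
      unfolding partial_sum_proj_def basis_coeffs_basis[OF sb] by (intro sum.cong) auto
    then show ?case using j by simp
  qed
qed

text \<open>
  On the span of \<open>e 0\<close>, the functional that sends \<open>c e 0\<close> to \<open>c \<parallel>e 0\<parallel>\<close> is isometric, hence it
  forms a state with the normalised vector. The projection onto this span extends it.
\<close>

lemma states_on_span_basis_nonempty:
  assumes "monotone_basis scale e"
  shows "states_on scale (span (e ` {..m})) \<noteq> {}"
proof -
  have sb: "schauder_basis scale e" using assms by (simp add: monotone_basis_def)
  interpret P0: contractive_projection scale "partial_sum_proj scale e 0" "span (e ` {..0})"
    by (rule contractive_projection_partial_sum[OF assms])
  define f where "f y = basis_coeffs scale e y 0 * of_real (norm (e 0))" for y
  define x where "x = scale (of_real (1 / norm (e 0))) (e 0)"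
  have e0: "norm (e 0) > 0" using basis_nonzero[OF sb] by simp
  have x: "x \<in> span (e ` {..0})" "f x = 1"
    using e0 by (auto simp: x_def f_def span_scale span_base
        basis_coeffs_scale[OF sb] basis_coeffs_basis[OF sb])
  have nx: "norm x = 1"
    unfolding x_def norm_scale norm_of_real using e0 by simp
  have nf: "norm (f y) = norm y" if "y \<in> span (e ` {..0})" for y
    using P0.proj_id[OF that] by (simp add: partial_sum_proj_def f_def norm_mult flip: norm_scale)
  have bl: "bounded_linear_on scale (*) (span (e ` {..0})) f"
    unfolding bounded_linear_on_def
  proof (intro conjI ballI allI exI)
    fix y assume "y \<in> span (e ` {..0})"
    then show "norm (f y) \<le> norm y * 1" using nf by simp
  qed (auto simp: f_def basis_coeffs_add[OF sb] basis_coeffs_scale[OF sb] algebra_simps)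
  have "onorm_on (span (e ` {..0})) f = 1"
  proof (rule antisym)
    show "onorm_on (span (e ` {..0})) f \<le> 1"
      by (rule onorm_on_le) (use nf x in auto)
    show "1 \<le> onorm_on (span (e ` {..0})) f"
      using norm_le_onorm_on[OF bl x(1)] x nx by simp
  qed
  then have "(x, f) \<in> states_on scale (span (e ` {..0}))"
    using x nx bl by (simp add: states_on_def dual_on_def)
  from P0.state_extension[OF this, of "span (e ` {..m})"] show ?thesis
    using span_mono[of "e ` {..0}" "e ` {..m}"] by auto
qed

lemma compression_tendsto:
  assumes mb: "monotone_basis scale e" and T: "T \<in> operators_on scale UNIV"
  shows "(\<lambda>m. partial_sum_proj scale e m (T (partial_sum_proj scale e m z))) \<longlonglongrightarrow> T z"
proof -
  let ?P = "partial_sum_proj scale e"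
  have sb: "schauder_basis scale e" using mb by (simp add: monotone_basis_def)
  have bl: "bounded_linear_on scale scale UNIV T"
    using T by (simp add: operators_on_def)
  interpret T: additive T using bl by unfold_locales (simp add: bounded_linear_on_def)
  \<comment> \<open>The projections are contractive, so the outer one does not enlarge the inner error.\<close>
  have bound: "norm (?P m (T (?P m z)) - T z)
      \<le> onorm_on UNIV T * norm (?P m z - z) + norm (?P m (T z) - T z)" for m
  proof -
    interpret contractive_projection scale "?P m" "span (e ` {..m})"
      by (rule contractive_projection_partial_sum[OF mb])
    have "?P m (T (?P m z)) = ?P m (T (?P m z - z)) + ?P m (T z)"
      by (simp add: T.diff flip: proj_add)
    then have "norm (?P m (T (?P m z)) - T z)
        \<le> norm (?P m (T (?P m z - z))) + norm (?P m (T z) - T z)"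
      by (metis add_diff_eq norm_triangle_ineq)
    with norm_proj_le[of "T (?P m z - z)"] norm_le_onorm_on[OF bl, of "?P m z - z"]
    show ?thesis by simp
  qed
  have "(\<lambda>m. onorm_on UNIV T * norm (?P m z - z) + norm (?P m (T z) - T z)) \<longlonglongrightarrow>
      onorm_on UNIV T * norm (z - z) + norm (T z - T z)"
    by (intro tendsto_intros partial_sum_proj_tendsto[OF sb])
  then have "(\<lambda>m. ?P m (T (?P m z)) - T z) \<longlonglongrightarrow> 0"
    by (intro Lim_null_comparison[OF always_eventually[OF allI[OF bound]]]) simp
  then show ?thesis by (simp add: LIM_zero_iff)
qed

text \<open>
  A \<open>c\<close> above the numerical radius \<open>v\<close> of \<open>T\<close> gives \<open>v / c < 1\<close>, so some vector \<open>z\<close> satisfies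
  \<open>\<parallel>T z\<parallel> > (v / c) \<parallel>z\<parallel>\<close>. For large indices the same inequality holds for the compressions at the projections of
  \<open>z\<close>, and so their norms exceed \<open>v / c\<close> while their numerical radii stay at most \<open>v\<close>.
\<close>

lemma eventually_numerical_index_span_le:
  assumes mb: "monotone_basis scale e" and T: "T \<in> operators_on scale UNIV"
    and nT: "onorm_on UNIV T = 1" and c: "numerical_radius scale UNIV T < c"
  shows "\<forall>\<^sub>F m in sequentially. numerical_index scale (span (e ` {..m})) \<le> c"
proof -
  let ?P = "partial_sum_proj scale e" and ?v = "numerical_radius scale UNIV T"
  have "states_on scale UNIV \<noteq> {}"
  proof -
    interpret contractive_projection scale "?P 0" "span (e ` {..0})"
      by (rule contractive_projection_partial_sum[OF mb])
    show ?thesis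
      using states_on_span_basis_nonempty[OF mb, of 0] state_extension[OF _ subspace_UNIV] by fast
  qed
  then have v: "0 \<le> ?v" by (rule numerical_radius_nonneg[OF _ T])
  then have c0: "0 < c" using c by simp
  have "\<exists>z. ?v / c * norm z < norm (T z)"
  proof (rule ccontr)
    assume "\<not> ?thesis"
    then have "onorm_on UNIV T \<le> ?v / c"
      using v c0 by (intro onorm_on_le) (auto simp: not_less)
    with nT c c0 show False by simp
  qed
  then obtain z where z: "?v / c * norm z < norm (T z)" ..
  have "(\<lambda>m. norm (?P m (T (?P m z)))) \<longlonglongrightarrow> norm (T z)"
    by (intro tendsto_norm compression_tendsto[OF mb T])
  from order_tendstoD(1)[OF this z] show ?thesis
  proof eventually_elim
    case (elim m)
    interpret contractive_projection scale "?P m" "span (e ` {..m})"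
      by (rule contractive_projection_partial_sum[OF mb])
    define S where "S = (\<lambda>x. ?P m (T x))"
    let ?X = "span (e ` {..m})"
    have st: "states_on scale ?X \<noteq> {}" by (rule states_on_span_basis_nonempty[OF mb])
    have S: "S \<in> operators_on scale ?X"
      unfolding S_def by (rule compression_operator[OF T])
    have "?v / c * norm (?P m z) \<le> ?v / c * norm z"
      using v c0 norm_proj_le[of z] by (intro mult_left_mono) auto
    also have "\<dots> < norm (S (?P m z))" using elim by (simp add: S_def)
    also have "\<dots> \<le> onorm_on ?X S * norm (?P m z)"
      using S by (intro norm_le_onorm_on[OF _ proj_mem]) (auto simp: operators_on_def)
    finally have "?v / c < onorm_on ?X S"
      by (rule mult_right_less_imp_less) simp
    then have less: "?v < c * onorm_on ?X S" and pos: "0 < onorm_on ?X S"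
      using v c0 by (auto simp: divide_simps mult.commute intro: le_less_trans[of 0 "?v / c"])
    have "numerical_index scale ?X * onorm_on ?X S \<le> numerical_radius scale ?X S"
      by (rule numerical_index_mult_onorm_le[OF subspace st S pos])
    also have "\<dots> \<le> ?v"
      unfolding S_def by (rule numerical_radius_compression_le[OF st T])
    finally show ?case using less pos
      by (meson le_less_trans less_imp_le mult_less_cancel_right_pos)
  qed
qed

end

section \<open>The numerical index of a space with a monotone basis\<close>

theorem corollary5p2:
  fixes scale :: "'k::real_normed_field \<Rightarrow> 'a::banach \<Rightarrow> 'a"
    and e :: "nat \<Rightarrow> 'a"
  assumes "normed_space_over scale"
    and "monotone_basis scale e"
  shows "ereal (numerical_index scale UNIV) \<ge>
    limsup (\<lambda>m. ereal (numerical_index scale (module.span scale (e ` {..m}))))"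
proof -
  interpret normed_space_over scale by fact
  let ?L = "limsup (\<lambda>m. ereal (numerical_index scale (span (e ` {..m}))))"
  have le: "?L \<le> ereal c"
    if "T \<in> operators_on scale UNIV" "onorm_on UNIV T = 1" "numerical_radius scale UNIV T < c" for T c
    using eventually_numerical_index_span_le[OF assms(2) that]
    by (intro Limsup_bounded) (auto elim: eventually_mono)
  show ?thesis
  proof (rule ereal_le_epsilon2)
    fix d :: real assume d: "0 < d"
    \<comment> \<open>The identity shows that the infimum is not over the empty set.\<close>
    have "(\<lambda>x. x) \<in> {T \<in> operators_on scale UNIV. onorm_on UNIV T = 1}"
    proof -
      have "bounded_linear_on scale scale UNIV (\<lambda>x. x)"
        unfolding bounded_linear_on_def by (auto intro!: exI[of _ 1])
      moreover have "onorm_on UNIV (\<lambda>x::'a. x) = 1"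
      proof (rule antisym)
        show "onorm_on UNIV (\<lambda>x::'a. x) \<le> 1" by (rule onorm_on_le) auto
        have "e 0 \<noteq> 0" using assms(2) basis_nonzero by (auto simp: monotone_basis_def)
        with norm_le_onorm_on[OF calculation, of "e 0"]
        show "1 \<le> onorm_on UNIV (\<lambda>x::'a. x)" by simp
      qed
      ultimately show ?thesis by (simp add: operators_on_def)
    qed
    then have ne: "numerical_radius scale UNIV ` {T \<in> operators_on scale UNIV. onorm_on UNIV T = 1} \<noteq> {}"
      by blast
    have "\<exists>r\<in>numerical_radius scale UNIV ` {T \<in> operators_on scale UNIV. onorm_on UNIV T = 1}.
        r < numerical_index scale UNIV + d"
      using cInf_lessD[OF ne, of "numerical_index scale UNIV + d"] d
      by (auto simp: numerical_index_def)
    then show "?L \<le> ereal (numerical_index scale UNIV) + ereal d"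
      using le by auto
  qed
qed

end
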